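(* Let $F$ be an algebraically closed field of characteristic different from $2$, let $G$ be a group, and let $UT_2=UT_2(F)$ be endowed with a $G$-grading $\Gamma$ such that $\operatorname{supp}(\Gamma)$ generates $G$, and with a $G$-graded involution $*$ with respect to $\Gamma$. Let $f\in P_{m,l}^{G}$ be a multilinear graded $*$-polynomial. Then the image $f(UT_2)$ is a homogeneous vector subspace of $UT_2$.
   Context: $UT_n(F)$ is the algebra of $n\times n$ upper triangular matrices over $F$. An involution on an $F$-algebra $\mathcal{A}$ is (always of the first kind, i.e.) an $F$-linear map $*:\mathcal{A}\to\mathcal{A}$ with $(ab)^*=b^*a^*$ and $(a^* )^*=a$. A $G$-grading on $\mathcal{A}$ is a decomposition $\Gamma:\mathcal{A}=\bigoplus_{g\in G}\mathcal{A}_g$ into subspaces with $\mathcal{A}_g\mathcal{A}_h\subset\mathcal{A}_{gh}$; $\operatorname{supp}(\Gamma)=\{g\in G:\mathcal{A}_g\neq 0\}$. The involution $*$ is $G$-graded if $\mathcal{A}_g^*\subset\mathcal{A}_g$ for all $g\in G$. Put $\mathcal{S}_g=\{a\in\mathcal{A}_g: a^*=a\}$ and $\mathcal{K}_g=\{a\in\mathcal{A}_g:a^*=-a\}$. A subspace $\mathcal{V}\subset\mathcal{A}$ is homogeneous if $\mathcal{V}=\bigoplus_{g\in G}(\mathcal{V}\cap\mathcal{A}_g)$. Let $F\langle Y_G\cup Z_G\rangle$ be the free associative algebra on the variables $y_{i,g}$ (symmetric of degree $g$) and $z_{i,g}$ (skew-symmetric of degree $g$), $i\ge 1$, $g\in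 G$. For $m\ge 1$, $0\le l\le m$ and fixed degrees $g_1,\dots,g_m\in G$, set $\xi_i=y_{i,g_i}$ for $1\le i\le l$ and $\xi_i=z_{i,g_i}$ for $l+1\le i\le m$; then $P_{m,l}^{G}=\operatorname{span}_F\{\xi_{\sigma(1)}\cdots\xi_{\sigma(m)}:\sigma\in S_m\}$. For $f=f(y_{1,g_1},\dots,y_{l,g_l},z_{l+1,g_{l+1}},\dots,z_{m,g_m})\in P_{m,l}^{G}$, the image $f(\mathcal{A})$ is the set of all values $f(a_1,\dots,a_l,b_{l+1},\dots,b_m)$ with $a_i\in\mathcal{S}_{g_i}$ and $b_j\in\mathcal{K}_{g_j}$. *)

theory Defs
  imports "HOL-Analysis.Analysis" "HOL-Algebra.Generated_Groups"
    "HOL-Computational_Algebra.Polynomial" "HOL-Library.Poly_Mapping"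
begin

section \<open>Upper triangular matrices\<close>

definition mat_scale :: "'a::field \<Rightarrow> 'a^'n^'m \<Rightarrow> 'a^'n^'m" where
  "mat_scale c = map_matrix ((*) c)"

interpretation mat_vs: vector_space "mat_scale :: 'a::field \<Rightarrow> 'a^'n^'m \<Rightarrow> 'a^'n^'m"
  by unfold_locales (simp_all add: mat_scale_def map_matrix_def vec_eq_iff algebra_simps)

text \<open>Rows and columns are ordered by the linear order of the index type. In the numeral
  type \<open>2\<close> the numeral \<open>2\<close> denotes the same element as \<open>0\<close>, so the indices in increasing
  order are \<open>0, 1\<close>, and the entry below the diagonal is \<open>A $ 1 $ 0\<close>.\<close>

definition UT :: "('a::field^'n::{finite,linorder}^'n::{finite,linorder}) set" where
  "UT = {A. \<forall>i j. j < i \<longrightarrow> A $ i $ j = 0}"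

section \<open>Gradings and graded involutions\<close>

text \<open>The algebra \<open>A\<close> in what follows is a subset of a full matrix algebra, with the operations
  inherited from it.

  \<open>is_direct_sum I V W\<close>: the subspace \<open>V\<close> is the internal direct sum of its subspaces \<open>W i\<close>,
  \<open>i \<in> I\<close>. The (possibly infinite) family of components \<open>x\<close> of a vector is extended by \<open>0\<close>
  outside \<open>I\<close> so that it is unique as a function.\<close>

definition is_direct_sum :: "'i set \<Rightarrow> ('a::field^'n^'n) set \<Rightarrow> ('i \<Rightarrow> ('a^'n^'n) set) \<Rightarrow> bool" where
  "is_direct_sum I V W \<longleftrightarrow>
     mat_vs.subspace V \<and>
     (\<forall>i\<in>I. mat_vs.subspace (W i) \<and> W i \<subseteq> V) \<and>
     (\<forall>v\<in>V. \<exists>!x. (\<forall>i\<in>I. x i \<in> W i) \<and> (\<forall>i. i \<notin> I \<longrightarrow> x i = 0) \<and>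
                 finite {i. x i \<noteq> 0} \<and> v = (\<Sum>i | x i \<noteq> 0. x i))"

definition is_grading ::
  "('g, 'z) monoid_scheme \<Rightarrow> ('a::field^'n^'n) set \<Rightarrow> ('g \<Rightarrow> ('a^'n^'n) set) \<Rightarrow> bool" where
  "is_grading G A \<Gamma> \<longleftrightarrow>
     is_direct_sum (carrier G) A \<Gamma> \<and>
     (\<forall>g\<in>carrier G. \<forall>h\<in>carrier G. \<forall>a\<in>\<Gamma> g. \<forall>b\<in>\<Gamma> h. a ** b \<in> \<Gamma> (g \<otimes>\<^bsub>G\<^esub> h))"

definition grading_supp ::
  "('g, 'z) monoid_scheme \<Rightarrow> ('g \<Rightarrow> ('a::field^'n^'n) set) \<Rightarrow> 'g set" where
  "grading_supp G \<Gamma> = {g \<in> carrier G. \<Gamma> g \<noteq> {0}}"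

definition is_involution :: "('a::field^'n^'n) set \<Rightarrow> ('a^'n^'n \<Rightarrow> 'a^'n^'n) \<Rightarrow> bool" where
  "is_involution A star \<longleftrightarrow>
     (\<forall>a\<in>A. star a \<in> A) \<and>
     (\<forall>a\<in>A. \<forall>b\<in>A. star (a + b) = star a + star b) \<and>
     (\<forall>c. \<forall>a\<in>A. star (mat_scale c a) = mat_scale c (star a)) \<and>
     (\<forall>a\<in>A. \<forall>b\<in>A. star (a ** b) = star b ** star a) \<and>
     (\<forall>a\<in>A. star (star a) = a)"

definition is_graded_involution ::
  "('g, 'z) monoid_scheme \<Rightarrow> ('a::field^'n^'n) set \<Rightarrow> ('g \<Rightarrow> ('a^'n^'n) set) \<Rightarrow>
   ('a^'n^'n \<Rightarrow> 'a^'n^'n) \<Rightarrow> bool" where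
  "is_graded_involution G A \<Gamma> star \<longleftrightarrow>
     is_involution A star \<and> (\<forall>g\<in>carrier G. star ` \<Gamma> g \<subseteq> \<Gamma> g)"

definition sym_part ::
  "('g \<Rightarrow> ('a::field^'n^'n) set) \<Rightarrow> ('a^'n^'n \<Rightarrow> 'a^'n^'n) \<Rightarrow> 'g \<Rightarrow> ('a^'n^'n) set" where
  "sym_part \<Gamma> star g = {a \<in> \<Gamma> g. star a = a}"

definition skew_part ::
  "('g \<Rightarrow> ('a::field^'n^'n) set) \<Rightarrow> ('a^'n^'n \<Rightarrow> 'a^'n^'n) \<Rightarrow> 'g \<Rightarrow> ('a^'n^'n) set" where
  "skew_part \<Gamma> star g = {a \<in> \<Gamma> g. star a = - a}"

definition is_homogeneous_subspace ::
  "('g, 'z) monoid_scheme \<Rightarrow> ('a::field^'n^'n) set \<Rightarrow> ('g \<Rightarrow> ('a^'n^'n) set) \<Rightarrow>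
   ('a^'n^'n) set \<Rightarrow> bool" where
  "is_homogeneous_subspace G A \<Gamma> V \<longleftrightarrow>
     mat_vs.subspace V \<and> V \<subseteq> A \<and> is_direct_sum (carrier G) V (\<lambda>g. V \<inter> \<Gamma> g)"

section \<open>Multilinear graded *-polynomials\<close>

text \<open>Lists form the free monoid under concatenation, written additively because
  \<^theory>\<open>HOL-Library.Poly_Mapping\<close> takes exponents from an additive monoid. The type
  \<open>'x list \<Rightarrow>\<^sub>0 'a\<close> with its convolution product is therefore the free associative unital
  algebra over \<open>'a\<close> on \<open>'x\<close>.\<close>

instantiation list :: (type) monoid_add
begin
definition "0 = []"
definition "xs + ys = xs @ ys"
instance by standard (simp_all add: zero_list_def plus_list_def)
end

datatype 'g gvar = Sym_var nat 'g | Skew_var nat 'g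

type_synonym ('g, 'a) free_star_alg = "'g gvar list \<Rightarrow>\<^sub>0 'a"

definition free_scale :: "'a::field \<Rightarrow> ('x list \<Rightarrow>\<^sub>0 'a) \<Rightarrow> ('x list \<Rightarrow>\<^sub>0 'a)" where
  "free_scale c = Poly_Mapping.map ((*) c)"

lemma lookup_free_scale: "Poly_Mapping.lookup (free_scale c p) w = c * Poly_Mapping.lookup p w"
  by (simp add: free_scale_def Poly_Mapping.map.rep_eq when_def)

interpretation free_vs: vector_space "free_scale :: 'a::field \<Rightarrow> ('x list \<Rightarrow>\<^sub>0 'a) \<Rightarrow> _"
  by unfold_locales
    (rule poly_mapping_eqI, simp add: lookup_free_scale lookup_add algebra_simps)+

definition free_var :: "'x \<Rightarrow> 'x list \<Rightarrow>\<^sub>0 'a::field" where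
  "free_var v = Poly_Mapping.single [v] 1"

lemma prod_list_free_var: "(\<Prod>v\<leftarrow>vs. free_var v) = Poly_Mapping.single vs 1"
proof (induction vs)
  case Nil
  show ?case by (simp add: zero_list_def flip: single_one)
next
  case (Cons v vs)
  then show ?case by (simp add: free_var_def mult_single plus_list_def)
qed

definition ml_var :: "nat \<Rightarrow> (nat \<Rightarrow> 'g) \<Rightarrow> nat \<Rightarrow> 'g gvar" where
  "ml_var l deg i = (if i \<le> l then Sym_var i (deg i) else Skew_var i (deg i))"

definition multilinear_space ::
  "nat \<Rightarrow> nat \<Rightarrow> (nat \<Rightarrow> 'g) \<Rightarrow> ('g, 'a::field) free_star_alg set" where
  "multilinear_space m l deg =
     free_vs.span {\<Prod>i\<leftarrow>[1..<Suc m]. free_var (ml_var l deg (\<sigma> i)) | \<sigma>. \<sigma> permutes {1..m}}"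

definition poly_eval :: "('x \<Rightarrow> 'a::field^'n^'n) \<Rightarrow> ('x list \<Rightarrow>\<^sub>0 'a) \<Rightarrow> 'a^'n^'n" where
  "poly_eval \<theta> f =
     (\<Sum>w\<in>Poly_Mapping.keys f. mat_scale (Poly_Mapping.lookup f w) (foldr (**) (map \<theta> w) (mat 1)))"

text \<open>The substitution \<open>\<theta>\<close> is constrained only on the variables that occur in members of
  \<open>multilinear_space m l deg\<close>; its other values do not affect the evaluation of such polynomials.\<close>

definition poly_image ::
  "('g \<Rightarrow> ('a::field^'n^'n) set) \<Rightarrow> ('a^'n^'n \<Rightarrow> 'a^'n^'n) \<Rightarrow> nat \<Rightarrow> nat \<Rightarrow> (nat \<Rightarrow> 'g) \<Rightarrow>
   ('g, 'a) free_star_alg \<Rightarrow> ('a^'n^'n) set" where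
  "poly_image \<Gamma> star m l deg f =
     {poly_eval \<theta> f | \<theta>.
        (\<forall>i\<in>{1..l}. \<theta> (Sym_var i (deg i)) \<in> sym_part \<Gamma> star (deg i)) \<and>
        (\<forall>i\<in>{l+1..m}. \<theta> (Skew_var i (deg i)) \<in> skew_part \<Gamma> star (deg i))}"

end

theory Submission
  imports Defs
begin

text \<open>Let \<open>J = F e\<^sub>1\<^sub>2\<close> be the Jacobson radical of \<open>UT\<^sub>2\<close>. It is a one-dimensional ideal with
  \<open>J\<^sup>2 = 0\<close>, and this controls both halves of the statement.

  An involution maps \<open>J\<close> to itself, because \<open>J\<close> is the set of elements of square zero, and it
  exchanges the two diagonal entries of a matrix (\<open>involution_UT2_swaps_diagonal\<close>). So the diagonal
  of a symmetric matrix is \<open>(p, p)\<close> and that of a skew-symmetric one is \<open>(p, -p)\<close>: whatever its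
  degree, a variable ranges over a subspace \<open>V\<close> for which \<open>V / (V \<inter> J)\<close> has dimension at most one.

  For variables with such ranges the image of a multilinear polynomial \<open>f\<close> is a subspace
  (\<open>subspace_multilinear_image\<close>). Choose \<open>\<eta> x \<in> V x\<close> spanning \<open>V x\<close> modulo \<open>J\<close> and write
  a substitution as \<open>\<theta> x = \<alpha> x \<eta> x + \<beta> x e\<^sub>1\<^sub>2\<close>. As \<open>J\<^sup>2 = 0\<close>, a product with two factors in \<open>J\<close>
  vanishes, so the value of \<open>f\<close> is
  \<open>(\<Prod>x. \<alpha> x) u + (\<Sum>x. \<beta> x (\<Prod>y \<noteq> x. \<alpha> y) v x)\<close>, where \<open>u\<close> is the value at \<open>\<eta>\<close> and
  \<open>v x \<in> J\<close> is the value after \<open>\<eta> x\<close> has been replaced by \<open>e\<^sub>1\<^sub>2\<close>. If \<open>v x = 0\<close> for all \<open>x\<close> with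
  \<open>e\<^sub>1\<^sub>2 \<in> V x\<close>, the image is \<open>F u\<close>. Otherwise one such \<open>x\<close> suffices to reach
  all of \<open>F u + J\<close>: put \<open>\<alpha> y = 1\<close> and \<open>\<beta> y = 0\<close> for \<open>y \<noteq> x\<close>.

  Homogeneity holds because the image lies in a single component. The Cayley-Hamilton identity shows
  that \<open>e\<^sub>1\<^sub>2\<close> is homogeneous in every grading of \<open>UT\<^sub>2\<close> (\<open>E12_homogeneous\<close>), and then that every
  component of degree other than the identity lies in \<open>J\<close> (\<open>component_in_J\<close>). Hence
  either all variables have the identity as degree, and the image lies in the component of the
  identity, or some variable takes values in the ideal \<open>J\<close> only, and the image lies in \<open>J\<close>.\<close>

section \<open>Upper triangular two by two matrices\<close>

lemma index_2_cases: "(i :: 2) = 0 \<or> i = 1"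
proof -
  have "(2::2) = 0" by simp
  then show ?thesis using exhaust_2[of i] by metis
qed

lemma UNIV_2: "(UNIV :: 2 set) = {0, 1}"
  using index_2_cases by blast

lemma mat2_eq_iff:
  "(A :: 'a^2^2) = B \<longleftrightarrow> A$0$0 = B$0$0 \<and> A$0$1 = B$0$1 \<and> A$1$0 = B$1$0 \<and> A$1$1 = B$1$1"
proof -
  have "(\<forall>i::2. P i) \<longleftrightarrow> P 0 \<and> P 1" for P
    using index_2_cases by metis
  then show ?thesis by (simp add: vec_eq_iff)
qed
lemma mat2_mult_nth: "((A :: 'a::semiring_1^2^2) ** B)$i$j = A$i$0 * B$0$j + A$i$1 * B$1$j"
  by (simp add: matrix_matrix_mult_def UNIV_2)

lemma mat_scale_nth [simp]: "mat_scale c A $ i $ j = c * A $ i $ j"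
  by (simp add: mat_scale_def map_matrix_def)

lemma mat_scale_mult_left: "mat_scale c A ** B = mat_scale c (A ** B)"
  by (simp add: vec_eq_iff matrix_matrix_mult_def sum_distrib_left mult.assoc)

lemma mat_scale_mult_right: "A ** mat_scale c B = mat_scale c (A ** B)"
  by (simp add: vec_eq_iff matrix_matrix_mult_def sum_distrib_left mult.left_commute)

lemma matrix_mult_sum_right: "A ** (\<Sum>i\<in>I. B i) = (\<Sum>i\<in>I. A ** B i)"
  by (induction I rule: infinite_finite_induct) (simp_all add: matrix_add_ldistrib)

lemma matrix_add_rdistrib: "(B + C) ** A = B ** A + C ** A"
  by (simp add: matrix_matrix_mult_def sum.distrib distrib_right vec_eq_iff)

lemma matrix_mult_sum_left: "(\<Sum>i\<in>I. B i) ** A = (\<Sum>i\<in>I. B i ** A)"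
  by (induction I rule: infinite_finite_induct) (simp_all add: matrix_add_rdistrib)

lemma mem_UT2_iff: "A \<in> (UT :: ('a::field^2^2) set) \<longleftrightarrow> A$1$0 = 0"
proof -
  have "(0::2) < 1"
    by (simp add: less_bit0_def bit0.Rep_0 bit0.Rep_1)
  then have *: "(j < i) \<longleftrightarrow> j = 0 \<and> i = 1" for i j :: 2
    using index_2_cases[of i] index_2_cases[of j] by (metis less_asym less_irrefl)
  show ?thesis by (auto simp: UT_def *)
qed

text \<open>The Jacobson radical of the triangular algebra.\<close>

definition J :: "('a::field^2^2) set" where
  "J = {A \<in> UT. A$0$0 = 0 \<and> A$1$1 = 0}"

definition E12 :: "'a::field^2^2" where
  "E12 = (\<chi> i j. if i = 0 \<and> j = 1 then 1 else 0)"

lemma E12_nth [simp]: "E12$0$0 = 0" "E12$0$1 = 1" "E12$1$0 = 0" "E12$1$1 = 0"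
  by (simp_all add: E12_def)

lemma mem_J_iff: "A \<in> J \<longleftrightarrow> A$0$0 = 0 \<and> A$1$0 = 0 \<and> A$1$1 = 0"
  by (auto simp: J_def mem_UT2_iff)

lemma J_subset_UT: "J \<subseteq> UT"
  by (auto simp: J_def)

lemma E12_in_J: "E12 \<in> J"
  by (simp add: mem_J_iff)

lemma E12_neq_0: "(E12 :: 'a::field^2^2) \<noteq> 0"
  by (simp add: mat2_eq_iff)

lemma J_eq_scale_E12: "A \<in> J \<Longrightarrow> A = mat_scale (A$0$1) E12"
  by (simp add: mem_J_iff mat2_eq_iff)

lemma subspace_J: "mat_vs.subspace J"
  by (auto simp: mat_vs.subspace_def mem_J_iff)

lemma UT2_mult: "A \<in> UT \<Longrightarrow> B \<in> UT \<Longrightarrow> A ** B \<in> (UT :: ('a::field^2^2) set)"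
  by (simp add: mem_UT2_iff mat2_mult_nth)

lemma one_in_UT2: "mat 1 \<in> (UT :: ('a::field^2^2) set)"
  by (simp add: mem_UT2_iff mat_def)

lemma J_mult_UT: "A \<in> J \<Longrightarrow> B \<in> UT \<Longrightarrow> A ** B \<in> J"
  and UT_mult_J: "B \<in> UT \<Longrightarrow> A \<in> J \<Longrightarrow> B ** A \<in> J"
  and J_mult_J: "A \<in> J \<Longrightarrow> A' \<in> J \<Longrightarrow> A ** A' = 0"
  by (simp_all add: mem_J_iff mem_UT2_iff mat2_mult_nth mat2_eq_iff)

lemma UT_mult_E12: "A \<in> UT \<Longrightarrow> A ** E12 = mat_scale (A$0$0) E12"
  and E12_mult_UT: "A \<in> UT \<Longrightarrow> E12 ** A = mat_scale (A$1$1) E12"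
  by (simp_all add: mem_UT2_iff mat2_mult_nth mat2_eq_iff)

text \<open>The Cayley-Hamilton identity. In a graded algebra it relates an element of degree \<open>g\<close> to
  elements of degrees \<open>g\<^sup>2\<close> and \<open>1\<close>, which forces \<open>g = 1\<close> unless the trace vanishes.\<close>

lemma UT2_square:
  assumes "A \<in> (UT :: ('a::field^2^2) set)"
  shows "mat_scale (A$0$0 + A$1$1) A = A ** A + mat_scale (A$0$0 * A$1$1) (mat 1)"
  using assms by (simp add: mem_UT2_iff mat2_mult_nth mat2_eq_iff mat_def algebra_simps)

text \<open>The Cayley-Hamilton identity for trace zero, polarized.\<close>

lemma UT2_traceless_anticommutator:
  assumes "A \<in> (UT :: ('a::field^2^2) set)" "B \<in> UT" "A$1$1 = - A$0$0" "B$1$1 = - B$0$0"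
  shows "A ** B + B ** A = mat_scale (2 * A$0$0 * B$0$0) (mat 1)"
  using assms by (simp add: mem_UT2_iff mat2_mult_nth mat2_eq_iff mat_def algebra_simps)

section \<open>Images of multilinear polynomials on subspaces of the triangular algebra\<close>

definition word_eval :: "('x \<Rightarrow> 'a::field^'n^'n) \<Rightarrow> 'x list \<Rightarrow> 'a^'n^'n" where
  "word_eval \<theta> w = foldr (**) (map \<theta> w) (mat 1)"

lemma word_eval_Nil [simp]: "word_eval \<theta> [] = mat 1"
  and word_eval_Cons [simp]: "word_eval \<theta> (x # w) = \<theta> x ** word_eval \<theta> w"
  by (simp_all add: word_eval_def)

lemma poly_eval_word_eval:
  "poly_eval \<theta> f =
     (\<Sum>w\<in>Poly_Mapping.keys f. mat_scale (Poly_Mapping.lookup f w) (word_eval \<theta> w))"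
  by (simp add: poly_eval_def word_eval_def)

lemma word_eval_cong: "(\<And>x. x \<in> set w \<Longrightarrow> \<theta> x = \<theta>' x) \<Longrightarrow> word_eval \<theta> w = word_eval \<theta>' w"
  by (induction w) simp_all

lemma poly_eval_in_subspace:
  assumes "mat_vs.subspace V" "\<And>w. w \<in> Poly_Mapping.keys f \<Longrightarrow> word_eval \<theta> w \<in> V"
  shows "poly_eval \<theta> f \<in> V"
  unfolding poly_eval_word_eval
  by (intro mat_vs.subspace_sum mat_vs.subspace_scale assms)

lemma word_eval_UT:
  "(\<And>x. x \<in> set w \<Longrightarrow> \<theta> x \<in> UT) \<Longrightarrow> word_eval \<theta> w \<in> (UT :: ('a::field^2^2) set)"
  by (induction w) (simp_all add: one_in_UT2 UT2_mult)

lemma word_eval_J: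
  assumes "\<And>x. x \<in> set w \<Longrightarrow> \<theta> x \<in> UT" "y \<in> set w" "\<theta> y \<in> J"
  shows "word_eval \<theta> w \<in> J"
  using assms
proof (induction w)
  case (Cons x w)
  then show ?case
    by (cases "y = x") (auto intro: J_mult_UT UT_mult_J word_eval_UT)
qed simp

text \<open>Expanding the product, every term that takes \<open>e\<^sub>1\<^sub>2\<close> from two or more factors vanishes because
  \<open>J\<close> is an ideal of square zero, so only the terms of order at most one in \<open>\<beta>\<close> survive.\<close>

lemma word_eval_expansion:
  fixes \<eta> :: "'x \<Rightarrow> 'a::field^2^2"
  assumes "distinct w" "\<And>x. x \<in> set w \<Longrightarrow> \<eta> x \<in> UT"
    and "\<And>x. x \<in> set w \<Longrightarrow> \<theta> x = mat_scale (\<alpha> x) (\<eta> x) + mat_scale (\<beta> x) E12"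
  shows "word_eval \<theta> w = mat_scale (\<Prod>x\<in>set w. \<alpha> x) (word_eval \<eta> w) +
    (\<Sum>x\<in>set w. mat_scale (\<beta> x * (\<Prod>y\<in>set w - {x}. \<alpha> y)) (word_eval (\<eta>(x := E12)) w))"
  using assms
proof (induction w)
  case (Cons x w)
  let ?W = "word_eval \<eta> w"
  let ?c = "\<lambda>z. \<beta> z * (\<Prod>y\<in>set w - {z}. \<alpha> y)"
  let ?U = "\<lambda>z. word_eval (\<eta>(z := E12)) w"
  have x: "x \<notin> set w" using Cons.prems by simp
  have IH: "word_eval \<theta> w = mat_scale (\<Prod>x\<in>set w. \<alpha> x) ?W + (\<Sum>z\<in>set w. mat_scale (?c z) (?U z))"
    by (rule Cons.IH) (use Cons.prems in auto)
  have U: "?U z \<in> J" if "z \<in> set w" for z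
    by (rule word_eval_J[of w _ z]) (use that Cons.prems E12_in_J J_subset_UT in auto)
  have 1: "\<eta> x ** word_eval \<theta> w = mat_scale (\<Prod>x\<in>set w. \<alpha> x) (\<eta> x ** ?W)
       + (\<Sum>z\<in>set w. mat_scale (?c z) (\<eta> x ** ?U z))"
    by (simp add: IH matrix_add_ldistrib mat_scale_mult_right matrix_mult_sum_right)
  have 2: "E12 ** word_eval \<theta> w = mat_scale (\<Prod>x\<in>set w. \<alpha> x) (E12 ** ?W)"
    by (simp add: IH matrix_add_ldistrib mat_scale_mult_right matrix_mult_sum_right
        J_mult_J[OF E12_in_J U])
  have 3: "word_eval (\<eta>(x := E12)) w = ?W"
    by (rule word_eval_cong) (use x in auto)
  have 4: "mat_scale (\<beta> z * (\<Prod>y\<in>set (x # w) - {z}. \<alpha> y)) (word_eval (\<eta>(z := E12)) (x # w))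
      = mat_scale (\<alpha> x) (mat_scale (?c z) (\<eta> x ** ?U z))" if "z \<in> set w" for z
  proof -
    have "z \<noteq> x" using that x by auto
    then have "set (x # w) - {z} = insert x (set w - {z})" by auto
    then have "(\<Prod>y\<in>set (x # w) - {z}. \<alpha> y) = \<alpha> x * (\<Prod>y\<in>set w - {z}. \<alpha> y)"
      using x by simp
    with \<open>z \<noteq> x\<close> show ?thesis by (simp add: mult_ac)
  qed
  have 5: "set (x # w) - {x} = set w" using x by auto
  define F where "F z = mat_scale (\<beta> z * (\<Prod>y\<in>set (x # w) - {z}. \<alpha> y))
    (word_eval (\<eta>(z := E12)) (x # w))" for z
  have "F x = mat_scale (\<beta> x * (\<Prod>x\<in>set w. \<alpha> x)) (E12 ** ?W)"
    unfolding F_def 5 using 3 by simp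
  moreover have "(\<Sum>z\<in>set w. F z) = (\<Sum>z\<in>set w. mat_scale (\<alpha> x) (mat_scale (?c z) (\<eta> x ** ?U z)))"
    unfolding F_def by (rule sum.cong[OF refl 4])
  ultimately have 6: "(\<Sum>z\<in>set (x # w). F z) = mat_scale (\<beta> x * (\<Prod>x\<in>set w. \<alpha> x)) (E12 ** ?W)
        + (\<Sum>z\<in>set w. mat_scale (\<alpha> x) (mat_scale (?c z) (\<eta> x ** ?U z)))"
    using x by simp
  moreover have "word_eval \<theta> (x # w) = mat_scale (\<alpha> x) (\<eta> x ** word_eval \<theta> w)
      + mat_scale (\<beta> x) (E12 ** word_eval \<theta> w)"
    using Cons.prems by (simp add: matrix_add_rdistrib mat_scale_mult_left)
  ultimately show ?case
    unfolding F_def[symmetric] 6 using x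
    by (simp add: 1 2 mat_vs.scale_right_distrib mat_vs.scale_sum_right add_ac)
qed simp

text \<open>Multilinearity as a condition on the support: each monomial contains every variable in
  \<open>X\<close> exactly once, and no others.\<close>

definition multilinear_in :: "'x set \<Rightarrow> ('x list \<Rightarrow>\<^sub>0 'a::zero) \<Rightarrow> bool" where
  "multilinear_in X f \<longleftrightarrow> (\<forall>w\<in>Poly_Mapping.keys f. distinct w \<and> set w = X)"

lemma poly_eval_expansion:
  fixes \<eta> :: "'x \<Rightarrow> 'a::field^2^2"
  assumes "multilinear_in X f" "\<And>x. x \<in> X \<Longrightarrow> \<eta> x \<in> UT"
    and "\<And>x. x \<in> X \<Longrightarrow> \<theta> x = mat_scale (\<alpha> x) (\<eta> x) + mat_scale (\<beta> x) E12"
  shows "poly_eval \<theta> f = mat_scale (\<Prod>x\<in>X. \<alpha> x) (poly_eval \<eta> f) +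
    (\<Sum>x\<in>X. mat_scale (\<beta> x * (\<Prod>y\<in>X - {x}. \<alpha> y)) (poly_eval (\<eta>(x := E12)) f))"
proof -
  let ?K = "Poly_Mapping.keys f" and ?l = "Poly_Mapping.lookup f"
  let ?c = "\<lambda>x. \<beta> x * (\<Prod>y\<in>X - {x}. \<alpha> y)"
  have "poly_eval \<theta> f = (\<Sum>w\<in>?K. mat_scale (?l w) (mat_scale (\<Prod>x\<in>X. \<alpha> x) (word_eval \<eta> w) +
      (\<Sum>x\<in>X. mat_scale (?c x) (word_eval (\<eta>(x := E12)) w))))"
    unfolding poly_eval_word_eval
  proof (intro sum.cong refl arg_cong[where f = "mat_scale _"])
    fix w assume "w \<in> ?K"
    then have "distinct w" "set w = X" using assms(1) by (auto simp: multilinear_in_def)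
    then show "word_eval \<theta> w = mat_scale (\<Prod>x\<in>X. \<alpha> x) (word_eval \<eta> w) +
        (\<Sum>x\<in>X. mat_scale (?c x) (word_eval (\<eta>(x := E12)) w))"
      using word_eval_expansion[of w \<eta> \<theta> \<alpha> \<beta>] assms(2,3) by auto
  qed
  also have "\<dots> = mat_scale (\<Prod>x\<in>X. \<alpha> x) (poly_eval \<eta> f) +
      (\<Sum>w\<in>?K. \<Sum>x\<in>X. mat_scale (?c x) (mat_scale (?l w) (word_eval (\<eta>(x := E12)) w)))"
    by (simp add: poly_eval_word_eval mat_vs.scale_right_distrib mat_vs.scale_sum_right
        sum.distrib mult_ac)
  also have "(\<Sum>w\<in>?K. \<Sum>x\<in>X. mat_scale (?c x) (mat_scale (?l w) (word_eval (\<eta>(x := E12)) w)))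
      = (\<Sum>x\<in>X. mat_scale (?c x) (poly_eval (\<eta>(x := E12)) f))"
    by (subst sum.swap) (simp add: poly_eval_word_eval mat_vs.scale_sum_right)
  finally show ?thesis .
qed

text \<open>For a subspace \<open>V\<close> this says that \<open>V / (V \<inter> J)\<close> has dimension at most one. The witness
  \<open>\<eta>\<close> may be zero, so subspaces of \<open>J\<close> are included.\<close>

definition line_mod_J :: "('a::field^2^2) set \<Rightarrow> bool" where
  "line_mod_J V \<longleftrightarrow> (\<exists>\<eta>\<in>V. \<forall>a\<in>V. \<exists>c. a - mat_scale c \<eta> \<in> J)"

text \<open>By the expansion the image lies in \<open>F u\<close> or, if some first-order coefficient contributes, in
  \<open>F u + J\<close>, where \<open>u\<close> is the value at the chosen generators \<open>\<eta>\<close>. In either case a single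
  variable, with the others fixed at \<open>\<eta>\<close>, reaches all of this space, and \<open>f\<close> is linear in one
  variable.\<close>

lemma subspace_multilinear_image:
  fixes V :: "'x \<Rightarrow> ('a::field^2^2) set"
  assumes f: "multilinear_in X f" and X: "finite X" "X \<noteq> {}"
    and V: "\<And>x. x \<in> X \<Longrightarrow> mat_vs.subspace (V x)" "\<And>x. x \<in> X \<Longrightarrow> V x \<subseteq> UT"
      "\<And>x. x \<in> X \<Longrightarrow> line_mod_J (V x)"
  shows "mat_vs.subspace {poly_eval \<theta> f | \<theta>. \<forall>x\<in>X. \<theta> x \<in> V x}" (is "mat_vs.subspace ?I")
proof -
  obtain \<eta> where \<eta>: "\<And>x. x \<in> X \<Longrightarrow> \<eta> x \<in> V x"
    and \<eta>J: "\<And>x a. x \<in> X \<Longrightarrow> a \<in> V x \<Longrightarrow> \<exists>c. a - mat_scale c (\<eta> x) \<in> J"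
    using V(3) unfolding line_mod_J_def by metis
  have \<eta>UT: "\<eta> x \<in> UT" if "x \<in> X" for x using that \<eta> V(2) by blast
  define u where "u = poly_eval \<eta> f"
  have coeff_J: "poly_eval (\<eta>(x := E12)) f \<in> J" if "x \<in> X" for x
  proof (rule poly_eval_in_subspace[OF subspace_J])
    fix w assume "w \<in> Poly_Mapping.keys f"
    then have "set w = X" using f by (auto simp: multilinear_in_def)
    then show "word_eval (\<eta>(x := E12)) w \<in> J"
      by (intro word_eval_J[of w _ x]) (use that \<eta>UT E12_in_J J_subset_UT in auto)
  qed
  have expand: "\<exists>\<alpha> \<beta>. (\<forall>x\<in>X. E12 \<notin> V x \<longrightarrow> \<beta> x = 0) \<and>
      poly_eval \<theta> f = mat_scale (\<Prod>x\<in>X. \<alpha> x) u +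
        (\<Sum>x\<in>X. mat_scale (\<beta> x * (\<Prod>y\<in>X - {x}. \<alpha> y)) (poly_eval (\<eta>(x := E12)) f))"
    if \<theta>: "\<forall>x\<in>X. \<theta> x \<in> V x" for \<theta>
  proof -
    have "\<forall>x\<in>X. \<exists>c. \<theta> x - mat_scale c (\<eta> x) \<in> J" using \<eta>J \<theta> by blast
    then obtain \<alpha> where \<alpha>: "\<And>x. x \<in> X \<Longrightarrow> \<theta> x - mat_scale (\<alpha> x) (\<eta> x) \<in> J" by metis
    define \<beta> where "\<beta> x = (\<theta> x - mat_scale (\<alpha> x) (\<eta> x)) $ 0 $ 1" for x
    have diff: "\<theta> x - mat_scale (\<alpha> x) (\<eta> x) = mat_scale (\<beta> x) E12" if "x \<in> X" for x
      unfolding \<beta>_def by (rule J_eq_scale_E12) (rule \<alpha>[OF that])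
    have \<theta>_eq: "\<theta> x = mat_scale (\<alpha> x) (\<eta> x) + mat_scale (\<beta> x) E12" if "x \<in> X" for x
      using diff[OF that] by (simp add: algebra_simps)
    \<comment> \<open>Where \<open>e\<^sub>1\<^sub>2\<close> is not available in \<open>V x\<close>, the subspace \<open>V x\<close> is the line spanned by \<open>\<eta> x\<close>.\<close>
    have "\<beta> x = 0" if "x \<in> X" "E12 \<notin> V x" for x
    proof (rule ccontr)
      assume "\<beta> x \<noteq> 0"
      have "mat_scale (\<beta> x) E12 \<in> V x"
        unfolding diff[OF that(1), symmetric]
        using that \<theta> \<eta> V(1) by (intro mat_vs.subspace_diff mat_vs.subspace_scale) auto
      then have "mat_scale (1 / \<beta> x) (mat_scale (\<beta> x) E12) \<in> V x"
        by (rule mat_vs.subspace_scale[OF V(1)[OF that(1)]])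
      with \<open>\<beta> x \<noteq> 0\<close> that(2) show False by simp
    qed
    then show ?thesis
      unfolding u_def
      by (intro exI[of _ \<alpha>] exI[of _ \<beta>] conjI ballI impI poly_eval_expansion[OF f \<eta>UT \<theta>_eq])
  qed
  show ?thesis
  proof (cases "\<exists>x\<in>X. E12 \<in> V x \<and> poly_eval (\<eta>(x := E12)) f \<noteq> 0")
    case False
    have "?I = mat_vs.span {u}"
    proof (intro equalityI subsetI)
      fix v assume "v \<in> ?I"
      then obtain \<theta> where \<theta>: "\<forall>x\<in>X. \<theta> x \<in> V x" "v = poly_eval \<theta> f" by blast
      obtain \<alpha> \<beta> where \<beta>: "\<forall>x\<in>X. E12 \<notin> V x \<longrightarrow> \<beta> x = 0" and "v = mat_scale (\<Prod>x\<in>X. \<alpha> x) u +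
        (\<Sum>x\<in>X. mat_scale (\<beta> x * (\<Prod>y\<in>X - {x}. \<alpha> y)) (poly_eval (\<eta>(x := E12)) f))"
        using expand[OF \<theta>(1)] \<theta>(2) by blast
      moreover have
        "(\<Sum>x\<in>X. mat_scale (\<beta> x * (\<Prod>y\<in>X - {x}. \<alpha> y)) (poly_eval (\<eta>(x := E12)) f)) = 0"
      proof (intro sum.neutral ballI)
        fix x assume "x \<in> X"
        then have "\<beta> x = 0 \<or> poly_eval (\<eta>(x := E12)) f = 0"
          using \<beta> False by blast
        then show "mat_scale (\<beta> x * (\<Prod>y\<in>X - {x}. \<alpha> y)) (poly_eval (\<eta>(x := E12)) f) = 0"
          by auto
      qed
      ultimately show "v \<in> mat_vs.span {u}"
        by (auto simp: mat_vs.span_singleton)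
    next
      fix v assume "v \<in> mat_vs.span {u}"
      then obtain c where c: "v = mat_scale c u" by (auto simp: mat_vs.span_singleton)
      obtain x where x: "x \<in> X" using X by blast
      let ?\<theta> = "\<eta>(x := mat_scale c (\<eta> x))"
      have "poly_eval ?\<theta> f = mat_scale (\<Prod>y\<in>X. if y = x then c else 1) u +
          (\<Sum>y\<in>X. mat_scale (0 * (\<Prod>z\<in>X - {y}. if z = x then c else 1))
             (poly_eval (\<eta>(y := E12)) f))"
        unfolding u_def by (rule poly_eval_expansion[OF f \<eta>UT]) auto
      also have "\<dots> = v" using X x by (simp add: c prod.delta)
      finally have "poly_eval ?\<theta> f = v" .
      moreover have "\<forall>y\<in>X. ?\<theta> y \<in> V y" using \<eta> V(1) by (auto intro: mat_vs.subspace_scale)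
      ultimately show "v \<in> ?I" by blast
    qed
    then show ?thesis by (simp add: mat_vs.subspace_span)
  next
    case True
    then obtain x where x: "x \<in> X" "E12 \<in> V x" and nz: "poly_eval (\<eta>(x := E12)) f \<noteq> 0" by blast
    define d where "d = poly_eval (\<eta>(x := E12)) f $ 0 $ 1"
    have d: "poly_eval (\<eta>(x := E12)) f = mat_scale d E12"
      unfolding d_def by (rule J_eq_scale_E12[OF coeff_J[OF x(1)]])
    then have "d \<noteq> 0" using nz by auto
    have "?I = {mat_scale c u + j | c j. j \<in> J}"
    proof (intro equalityI subsetI)
      fix v assume "v \<in> ?I"
      then obtain \<theta> where \<theta>: "\<forall>x\<in>X. \<theta> x \<in> V x" "v = poly_eval \<theta> f" by blast
      obtain \<alpha> \<beta> where "v = mat_scale (\<Prod>x\<in>X. \<alpha> x) u +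
        (\<Sum>x\<in>X. mat_scale (\<beta> x * (\<Prod>y\<in>X - {x}. \<alpha> y)) (poly_eval (\<eta>(x := E12)) f))"
        using expand[OF \<theta>(1)] \<theta>(2) by blast
      moreover have
        "(\<Sum>x\<in>X. mat_scale (\<beta> x * (\<Prod>y\<in>X - {x}. \<alpha> y)) (poly_eval (\<eta>(x := E12)) f)) \<in> J"
        by (intro mat_vs.subspace_sum mat_vs.subspace_scale subspace_J coeff_J)
      ultimately show "v \<in> {mat_scale c u + j | c j. j \<in> J}" by blast
    next
      fix v assume "v \<in> {mat_scale c u + j | c j. j \<in> J}"
      then obtain c j where "j \<in> J" "v = mat_scale c u + j" by blast
      then obtain b where v: "v = mat_scale c u + mat_scale b E12"
        using J_eq_scale_E12 by metis
      \<comment> \<open>Only the variable \<open>x\<close> is moved, and \<open>f\<close> is linear in it. Replacing \<open>\<eta> x\<close> by \<open>e\<^sub>1\<^sub>2\<close> gives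
        \<open>d e\<^sub>1\<^sub>2\<close>, so the coefficient \<open>b / d\<close> produces \<open>b e\<^sub>1\<^sub>2\<close>.\<close>
      let ?\<theta> = "\<eta>(x := mat_scale c (\<eta> x) + mat_scale (b / d) E12)"
      have "poly_eval ?\<theta> f = mat_scale (\<Prod>y\<in>X. if y = x then c else 1) u +
          (\<Sum>y\<in>X. mat_scale ((if y = x then b / d else 0) * (\<Prod>z\<in>X - {y}. if z = x then c else 1))
             (poly_eval (\<eta>(y := E12)) f))"
        unfolding u_def by (rule poly_eval_expansion[OF f \<eta>UT]) auto
      also have "\<dots> = mat_scale c u + (\<Sum>y\<in>X. if y = x then mat_scale b E12 else 0)"
        using X x d \<open>d \<noteq> 0\<close> by (intro arg_cong2[where f = "(+)"] sum.cong) (auto simp: prod.delta)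
      also have "\<dots> = v" using X x v by simp
      finally have "poly_eval ?\<theta> f = v" .
      moreover have "\<forall>y\<in>X. ?\<theta> y \<in> V y"
        using \<eta> V(1) x by (auto intro!: mat_vs.subspace_scale mat_vs.subspace_add)
      ultimately show "v \<in> ?I" by blast
    qed
    also have "\<dots> = {a + b | a b. a \<in> mat_vs.span {u} \<and> b \<in> J}"
      by (auto simp: mat_vs.span_singleton)
    finally show ?thesis
      using mat_vs.subspace_sums[OF mat_vs.subspace_span subspace_J] by simp
  qed
qed

section \<open>Homogeneous components\<close>

locale graded_algebra = group G for G (structure) +
  fixes A :: "('a::field^'n^'n) set" and \<Gamma> :: "'g \<Rightarrow> ('a^'n^'n) set"
  assumes grading: "is_grading G A \<Gamma>"
begin

lemma subspace_A: "mat_vs.subspace A"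
  and subspace_component: "g \<in> carrier G \<Longrightarrow> mat_vs.subspace (\<Gamma> g)"
  and component_subset: "g \<in> carrier G \<Longrightarrow> \<Gamma> g \<subseteq> A"
  and component_mult: "a \<in> \<Gamma> g \<Longrightarrow> b \<in> \<Gamma> h \<Longrightarrow> g \<in> carrier G \<Longrightarrow> h \<in> carrier G \<Longrightarrow>
    a ** b \<in> \<Gamma> (g \<otimes> h)"
  using grading by (auto simp: is_grading_def is_direct_sum_def)

text \<open>The condition that determines the components in the definition of a direct sum; the family is
  extended by zero outside the group.\<close>

definition decomposes :: "'a^'n^'n \<Rightarrow> ('g \<Rightarrow> 'a^'n^'n) \<Rightarrow> bool" where
  "decomposes v x \<longleftrightarrow> (\<forall>g\<in>carrier G. x g \<in> \<Gamma> g) \<and> (\<forall>g. g \<notin> carrier G \<longrightarrow> x g = 0) \<and>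
     finite {g. x g \<noteq> 0} \<and> v = (\<Sum>g | x g \<noteq> 0. x g)"

definition hcomp :: "'a^'n^'n \<Rightarrow> 'g \<Rightarrow> 'a^'n^'n" where
  "hcomp v = (THE x. decomposes v x)"

lemma ex1_decomposes: "v \<in> A \<Longrightarrow> \<exists>!x. decomposes v x"
  using grading by (simp add: is_grading_def is_direct_sum_def decomposes_def)

lemma decomposes_hcomp: "v \<in> A \<Longrightarrow> decomposes v (hcomp v)"
  unfolding hcomp_def using theI'[OF ex1_decomposes] .

lemma hcomp_unique: "v \<in> A \<Longrightarrow> decomposes v x \<Longrightarrow> hcomp v = x"
  using ex1_decomposes decomposes_hcomp by blast

lemma hcomp_in: "v \<in> A \<Longrightarrow> g \<in> carrier G \<Longrightarrow> hcomp v g \<in> \<Gamma> g"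
  and hcomp_outside: "v \<in> A \<Longrightarrow> g \<notin> carrier G \<Longrightarrow> hcomp v g = 0"
  and finite_hcomp_supp: "v \<in> A \<Longrightarrow> finite {g. hcomp v g \<noteq> 0}"
  and sum_hcomp: "v \<in> A \<Longrightarrow> (\<Sum>g | hcomp v g \<noteq> 0. hcomp v g) = v"
  using decomposes_hcomp by (auto simp: decomposes_def)

lemma hcomp_eqI:
  assumes "v \<in> A" "\<And>g. g \<in> carrier G \<Longrightarrow> x g \<in> \<Gamma> g" "finite S" "S \<subseteq> carrier G"
    and "\<And>g. g \<notin> S \<Longrightarrow> x g = 0" "v = (\<Sum>g\<in>S. x g)"
  shows "hcomp v = x"
proof (rule hcomp_unique[OF assms(1)])
  have sub: "{g. x g \<noteq> 0} \<subseteq> S" using assms(5) by blast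
  have "(\<Sum>g\<in>S. x g) = (\<Sum>g | x g \<noteq> 0. x g)"
    by (rule sum.mono_neutral_right) (use assms(3) sub in auto)
  then show "decomposes v x"
    using assms sub by (auto simp: decomposes_def intro: finite_subset)
qed

lemma hcomp_homogeneous:
  assumes "v \<in> \<Gamma> g" "g \<in> carrier G"
  shows "hcomp v = (\<lambda>h. if h = g then v else 0)"
  by (rule hcomp_eqI[where S = "{g}"])
    (use assms component_subset mat_vs.subspace_0[OF subspace_component] in auto)

lemma hcomp_add:
  assumes "v \<in> A" "w \<in> A"
  shows "hcomp (v + w) = (\<lambda>g. hcomp v g + hcomp w g)"
proof (rule hcomp_eqI[where S = "{g. hcomp v g \<noteq> 0} \<union> {g. hcomp w g \<noteq> 0}"])
  let ?S = "{g. hcomp v g \<noteq> 0} \<union> {g. hcomp w g \<noteq> 0}"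
  show fin: "finite ?S" using assms finite_hcomp_supp by simp
  have "(\<Sum>g\<in>?S. hcomp v g) = v"
    by (subst (2) sum_hcomp[OF assms(1), symmetric], rule sum.mono_neutral_right)
      (use fin in auto)
  moreover have "(\<Sum>g\<in>?S. hcomp w g) = w"
    by (subst (2) sum_hcomp[OF assms(2), symmetric], rule sum.mono_neutral_right)
      (use fin in auto)
  ultimately show "v + w = (\<Sum>g\<in>?S. hcomp v g + hcomp w g)" by (simp add: sum.distrib)
qed (use assms hcomp_in hcomp_outside subspace_A subspace_component in
    \<open>auto intro: mat_vs.subspace_add\<close>)

lemma hcomp_sum:
  assumes "finite I" "\<And>i. i \<in> I \<Longrightarrow> v i \<in> A"
  shows "hcomp (\<Sum>i\<in>I. v i) g = (\<Sum>i\<in>I. hcomp (v i) g)"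
  using assms
proof (induction I rule: finite_induct)
  case empty
  have "0 \<in> \<Gamma> \<one>" by (rule mat_vs.subspace_0[OF subspace_component]) simp
  then show ?case by (simp add: hcomp_homogeneous)
next
  case (insert i I)
  then have "(\<Sum>i\<in>I. v i) \<in> A" by (intro mat_vs.subspace_sum[OF subspace_A]) auto
  with insert show ?case by (simp add: hcomp_add)
qed

text \<open>For \<open>a\<close> of degree \<open>h\<close>, comparing the components of degree \<open>h\<close> in \<open>a = a \<cdot> 1\<close> shows that
  the identity component \<open>u\<close> of \<open>1\<close> satisfies \<open>a u = a\<close>. So \<open>u\<close> is a right unit of the algebra, and
  \<open>1 = 1 \<cdot> u = u\<close>.\<close>

lemma one_homogeneous:
  assumes "mat 1 \<in> A"
  shows "mat 1 \<in> \<Gamma> \<one>"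
proof -
  let ?u = "hcomp (mat 1)" and ?S = "{g. hcomp (mat 1) g \<noteq> 0}"
  have S: "finite ?S" "?S \<subseteq> carrier G"
    using assms finite_hcomp_supp hcomp_outside by auto
  have right_unit: "a ** ?u \<one> = a" if a: "a \<in> \<Gamma> h" and h: "h \<in> carrier G" for a h
  proof -
    have mult: "a ** ?u g \<in> \<Gamma> (h \<otimes> g)" if "g \<in> carrier G" for g
      using a h that assms hcomp_in component_mult by blast
    have inA: "a ** ?u g \<in> A" if "g \<in> ?S" for g
      using mult S(2) that h component_subset[OF m_closed[OF h, of g]] by blast
    have "hcomp (\<Sum>g\<in>?S. a ** ?u g) h = (\<Sum>g\<in>?S. hcomp (a ** ?u g) h)"
      by (rule hcomp_sum) (use S inA in auto)
    also have "\<dots> = (\<Sum>g\<in>?S. if g = \<one> then a ** ?u \<one> else 0)"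
    proof (rule sum.cong[OF refl])
      fix g assume "g \<in> ?S"
      then have g: "g \<in> carrier G" using S by blast
      then have "h = h \<otimes> g \<longleftrightarrow> g = \<one>" using h by (metis l_cancel_one)
      then show "hcomp (a ** ?u g) h = (if g = \<one> then a ** ?u \<one> else 0)"
        using hcomp_homogeneous[OF mult[OF g]] g h by auto
    qed
    also have "\<dots> = a ** ?u \<one>" using S(1) by auto
    also have "(\<Sum>g\<in>?S. a ** ?u g) = a"
      by (simp add: sum_hcomp[OF assms] flip: matrix_mult_sum_right)
    finally show ?thesis using hcomp_homogeneous[OF a h] by simp
  qed
  have "mat 1 = (\<Sum>g\<in>?S. ?u g ** ?u \<one>)"
  proof (subst sum_hcomp[OF assms, symmetric], rule sum.cong[OF refl])
    fix g assume "g \<in> ?S"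
    then have g: "g \<in> carrier G" using S by blast
    show "?u g = ?u g ** ?u \<one>" using right_unit[OF hcomp_in[OF assms g] g] by simp
  qed
  also have "\<dots> = (\<Sum>g\<in>?S. ?u g) ** ?u \<one>"
    by (rule matrix_mult_sum_left[symmetric])
  also have "\<dots> = ?u \<one>" by (simp add: sum_hcomp[OF assms])
  finally show ?thesis using hcomp_in[OF assms one_closed] by simp
qed

lemma homogeneous_subspaceI:
  assumes "mat_vs.subspace V" "V \<subseteq> \<Gamma> g" "g \<in> carrier G"
  shows "is_homogeneous_subspace G A \<Gamma> V"
  unfolding is_homogeneous_subspace_def is_direct_sum_def
proof (intro conjI ballI)
  show VA: "V \<subseteq> A" using assms component_subset by blast
  fix v assume v: "v \<in> V"
  then have hc: "hcomp v = (\<lambda>h. if h = g then v else 0)"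
    using assms by (intro hcomp_homogeneous) auto
  have vA: "v \<in> A" using v VA by blast
  show "\<exists>!x. (\<forall>h\<in>carrier G. x h \<in> V \<inter> \<Gamma> h) \<and> (\<forall>h. h \<notin> carrier G \<longrightarrow> x h = 0) \<and>
      finite {h. x h \<noteq> 0} \<and> v = (\<Sum>h | x h \<noteq> 0. x h)"
  proof (rule ex1I[of _ "hcomp v"])
    have "hcomp v h \<in> V" for h
      using v mat_vs.subspace_0[OF assms(1)] by (simp add: hc)
    then show "(\<forall>h\<in>carrier G. hcomp v h \<in> V \<inter> \<Gamma> h) \<and> (\<forall>h. h \<notin> carrier G \<longrightarrow> hcomp v h = 0) \<and>
        finite {h. hcomp v h \<noteq> 0} \<and> v = (\<Sum>h | hcomp v h \<noteq> 0. hcomp v h)"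
      using decomposes_hcomp[OF vA] by (auto simp: decomposes_def)
  next
    fix x assume "(\<forall>h\<in>carrier G. x h \<in> V \<inter> \<Gamma> h) \<and> (\<forall>h. h \<notin> carrier G \<longrightarrow> x h = 0) \<and>
        finite {h. x h \<noteq> 0} \<and> v = (\<Sum>h | x h \<noteq> 0. x h)"
    then have "decomposes v x" by (auto simp: decomposes_def)
    then show "x = hcomp v" using hcomp_unique[OF vA] by simp
  qed
qed (use assms subspace_component in \<open>auto intro: mat_vs.subspace_inter\<close>)

end

section \<open>Gradings on the triangular algebra\<close>

locale graded_UT2 = graded_algebra G UT \<Gamma>
  for G (structure) and \<Gamma> :: "'g \<Rightarrow> ('a::field^2^2) set" +
  assumes char_neq_2: "CHAR('a) \<noteq> 2"
begin

lemma two_neq_0: "(2 :: 'a) \<noteq> 0"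
proof
  assume "(2 :: 'a) = 0"
  then have "of_nat 2 = (0 :: 'a)" by simp
  then have "CHAR('a) dvd 2" by (simp only: of_nat_eq_0_iff_char_dvd)
  then have "CHAR('a) = 1 \<or> CHAR('a) = 2"
    using two_is_prime_nat prime_nat_iff by blast
  then show False using char_neq_2 by auto
qed

lemma component_UT: "a \<in> \<Gamma> g \<Longrightarrow> g \<in> carrier G \<Longrightarrow> a \<in> UT"
  using component_subset by blast

lemma scalar_homogeneous: "mat_scale c (mat 1) \<in> \<Gamma> \<one>"
  by (intro mat_vs.subspace_scale subspace_component one_homogeneous one_in_UT2 one_closed)

text \<open>In \<open>tr(a) a = a\<^sup>2 + det(a)\<close> the right-hand side has components of degrees \<open>g\<^sup>2\<close> and \<open>1\<close> only, and
  both differ from \<open>g\<close>.\<close>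

lemma traceless_component:
  assumes a: "a \<in> \<Gamma> g" and g: "g \<in> carrier G" "g \<noteq> \<one>"
  shows "a$1$1 = - a$0$0"
proof (rule ccontr)
  assume tr: "a$1$1 \<noteq> - a$0$0"
  have "g \<otimes> g \<noteq> g" using g by (metis l_cancel_one)
  have sq: "a ** a \<in> \<Gamma> (g \<otimes> g)" using a g component_mult by blast
  let ?t = "mat_scale (a$0$0 + a$1$1) a" and ?d = "mat_scale (a$0$0 * a$1$1) (mat 1 :: 'a^2^2)"
  have t: "?t \<in> \<Gamma> g" using a g by (intro mat_vs.subspace_scale subspace_component)
  have "?t = a ** a + ?d" by (rule UT2_square[OF component_UT[OF a g(1)]])
  then have "hcomp ?t g = hcomp (a ** a) g + hcomp ?d g"
    using hcomp_add component_UT[OF sq] component_UT[OF scalar_homogeneous] g by simp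
  then have "?t = 0"
    using hcomp_homogeneous[OF t g(1)] hcomp_homogeneous[OF sq] g \<open>g \<otimes> g \<noteq> g\<close>
      hcomp_homogeneous[OF scalar_homogeneous] by simp
  then have "a = 0" using tr by (auto simp: eq_neg_iff_add_eq_0 add.commute)
  then show False using tr by simp
qed

text \<open>All components \<open>e g\<close> of \<open>e\<^sub>1\<^sub>2\<close> have trace zero: for \<open>g \<noteq> 1\<close> by the previous lemma, and then
  for \<open>g = 1\<close> because \<open>e\<^sub>1\<^sub>2\<close> has trace zero. If two of them, of degrees \<open>g\<close> and \<open>h\<close>, have
  nonzero diagonal, their anticommutator is a nonzero scalar matrix since the characteristic is not
  two. Scalar matrices have degree \<open>1\<close>, so \<open>g h = 1\<close>. This also applies to \<open>g = h\<close>, so all such degrees coincide. But the diagonals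
  of the components sum to zero, so a single nonzero one is impossible, and all components lie
  in the line \<open>J\<close>; any nonzero one is a multiple of \<open>e\<^sub>1\<^sub>2\<close>.\<close>

lemma E12_homogeneous:
  obtains \<gamma> where "\<gamma> \<in> carrier G" "E12 \<in> \<Gamma> \<gamma>"
proof -
  define e where "e = hcomp (E12 :: 'a^2^2)"
  let ?S = "{g. e g \<noteq> 0}"
  have UT: "E12 \<in> (UT :: ('a^2^2) set)" using E12_in_J J_subset_UT by blast
  have fin: "finite ?S" and S: "?S \<subseteq> carrier G" and sum: "(\<Sum>g\<in>?S. e g) = E12"
    and in_comp: "\<And>g. g \<in> carrier G \<Longrightarrow> e g \<in> \<Gamma> g"
    using finite_hcomp_supp[OF UT] hcomp_outside[OF UT] sum_hcomp[OF UT] hcomp_in[OF UT]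
    unfolding e_def by auto
  have entry: "(\<Sum>g\<in>?S. e g $ i $ j) = E12 $ i $ j" for i j
    unfolding sum[symmetric] by simp
  have e_UT: "e g \<in> UT" if "g \<in> carrier G" for g using in_comp component_UT that by blast
  have tr0: "e g $ 1 $ 1 = - e g $ 0 $ 0" if g: "g \<in> carrier G" for g
  proof (cases "g = \<one>")
    case False
    then show ?thesis using traceless_component in_comp g by blast
  next
    case True
    let ?tr = "\<lambda>g. e g $ 0 $ 0 + e g $ 1 $ 1"
    have "0 = (\<Sum>h\<in>?S. ?tr h)" by (simp add: sum.distrib entry)
    also have "\<dots> = (\<Sum>h\<in>?S. if h = \<one> then ?tr \<one> else 0)"
    proof (rule sum.cong[OF refl])
      fix h assume "h \<in> ?S"
      then have "h \<in> carrier G" using S by blast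
      then show "?tr h = (if h = \<one> then ?tr \<one> else 0)"
        using traceless_component[OF in_comp] by auto
    qed
    also have "\<dots> = ?tr \<one>" using fin by auto
    finally show ?thesis using True by (simp add: eq_neg_iff_add_eq_0 add.commute)
  qed
  have inverse: "g \<otimes> h = \<one>"
    if g: "g \<in> carrier G" "e g $ 0 $ 0 \<noteq> 0" and h: "h \<in> carrier G" "e h $ 0 $ 0 \<noteq> 0" for g h
  proof (rule ccontr)
    assume gh: "g \<otimes> h \<noteq> \<one>"
    then have hg: "h \<otimes> g \<noteq> \<one>" using g h by (metis inv_comm)
    let ?c = "mat_scale (2 * e g $ 0 $ 0 * e h $ 0 $ 0) (mat 1 :: 'a^2^2)"
    have 1: "e g ** e h \<in> \<Gamma> (g \<otimes> h)" and 2: "e h ** e g \<in> \<Gamma> (h \<otimes> g)"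
      using g h in_comp component_mult by blast+
    have "e g ** e h + e h ** e g = ?c"
      by (intro UT2_traceless_anticommutator e_UT tr0 g h)
    then have "hcomp ?c \<one> = hcomp (e g ** e h) \<one> + hcomp (e h ** e g) \<one>"
      using hcomp_add[OF component_UT[OF 1] component_UT[OF 2]] g h by simp
    then have "?c = 0"
      using hcomp_homogeneous[OF scalar_homogeneous] hcomp_homogeneous[OF 1]
        hcomp_homogeneous[OF 2] gh hg g h by simp
    then have "2 * e g $ 0 $ 0 * e h $ 0 $ 0 = 0"
      by (simp add: mat2_eq_iff mat_def)
    then show False using g h two_neq_0 by simp
  qed
  have diag0: "e g $ 0 $ 0 = 0" if g: "g \<in> carrier G" for g
  proof (rule ccontr)
    assume nz: "e g $ 0 $ 0 \<noteq> 0"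
    have "e h $ 0 $ 0 = 0" if "h \<in> carrier G" "h \<noteq> g" for h
      using inverse[OF g nz g nz] inverse[OF that(1) _ g nz] that g by (metis inv_equality)
    then have "(\<Sum>h\<in>?S. e h $ 0 $ 0) = (\<Sum>h\<in>?S. if h = g then e g $ 0 $ 0 else 0)"
      using S by (intro sum.cong) auto
    also have "\<dots> = e g $ 0 $ 0" using fin nz by auto
    finally show False using nz entry by simp
  qed
  have "?S \<noteq> {}"
  proof
    assume "?S = {}"
    then have "E12 = (0 :: 'a^2^2)" using sum by (metis sum.empty)
    then show False using E12_neq_0 by blast
  qed
  then obtain g where g: "g \<in> carrier G" "e g \<noteq> 0" using S by blast
  then have "e g \<in> J" using diag0 tr0 e_UT by (simp add: mem_J_iff mem_UT2_iff)
  then have eq: "e g = mat_scale (e g $ 0 $ 1) E12" by (rule J_eq_scale_E12)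
  then have nz: "e g $ 0 $ 1 \<noteq> 0" using g(2) by (metis mat_vs.scale_zero_left)
  have "mat_scale (1 / e g $ 0 $ 1) (e g) \<in> \<Gamma> g"
    using g in_comp by (intro mat_vs.subspace_scale subspace_component)
  moreover have "mat_scale (1 / e g $ 0 $ 1) (e g) = E12"
    by (subst (2) eq) (use nz in simp)
  ultimately show ?thesis using that g by simp
qed

lemma J_homogeneous:
  obtains \<gamma> where "\<gamma> \<in> carrier G" "J \<subseteq> \<Gamma> \<gamma>"
proof -
  obtain \<gamma> where \<gamma>: "\<gamma> \<in> carrier G" "E12 \<in> \<Gamma> \<gamma>" by (rule E12_homogeneous)
  have "a \<in> \<Gamma> \<gamma>" if "a \<in> J" for a
    by (subst J_eq_scale_E12[OF that]) (intro mat_vs.subspace_scale subspace_component \<gamma>)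
  then show ?thesis using \<gamma> that by blast
qed

text \<open>Let \<open>e\<^sub>1\<^sub>2\<close> have degree \<open>\<gamma>\<close>. The products \<open>a e\<^sub>1\<^sub>2\<close> and \<open>e\<^sub>1\<^sub>2 a\<close> are the multiples of
  \<open>e\<^sub>1\<^sub>2\<close> by the diagonal entries of \<open>a\<close>, yet their degrees \<open>g \<gamma>\<close> and \<open>\<gamma> g\<close> differ from \<open>\<gamma>\<close>.\<close>

lemma component_in_J:
  assumes g: "g \<in> carrier G" "g \<noteq> \<one>"
  shows "\<Gamma> g \<subseteq> J"
proof
  fix a assume a: "a \<in> \<Gamma> g"
  then have UT: "a \<in> UT" using component_UT g by blast
  obtain \<gamma> where \<gamma>: "\<gamma> \<in> carrier G" "E12 \<in> \<Gamma> \<gamma>" by (rule E12_homogeneous)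
  have zero: "c = 0" if "mat_scale c E12 \<in> \<Gamma> h" "h \<in> carrier G" "h \<noteq> \<gamma>" for c h
  proof -
    have "mat_scale c E12 \<in> \<Gamma> \<gamma>" by (intro mat_vs.subspace_scale subspace_component \<gamma>)
    then have "hcomp (mat_scale c E12) \<gamma> = mat_scale c E12"
      using \<gamma> by (simp add: hcomp_homogeneous)
    moreover have "hcomp (mat_scale c E12) \<gamma> = 0" using that by (simp add: hcomp_homogeneous)
    ultimately show ?thesis by (simp add: E12_neq_0)
  qed
  have "mat_scale (a$0$0) E12 \<in> \<Gamma> (g \<otimes> \<gamma>)" "mat_scale (a$1$1) E12 \<in> \<Gamma> (\<gamma> \<otimes> g)"
    using component_mult[OF a \<gamma>(2)] component_mult[OF \<gamma>(2) a] g \<gamma> UT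
    by (simp_all add: UT_mult_E12 E12_mult_UT)
  moreover have "g \<otimes> \<gamma> \<noteq> \<gamma>" "\<gamma> \<otimes> g \<noteq> \<gamma>" using g \<gamma> by (metis r_cancel_one, metis l_cancel_one)
  ultimately have "a$0$0 = 0" "a$1$1 = 0" using zero g \<gamma> by auto
  then show "a \<in> J" using UT by (simp add: J_def)
qed

end

section \<open>Involutions on the triangular algebra\<close>

text \<open>The elements of square zero form the line \<open>J\<close>, so \<open>e\<^sub>1\<^sub>2\<close> goes to a nonzero multiple of itself.
  Applying the involution to \<open>e\<^sub>1\<^sub>2 a = a\<^sub>2\<^sub>2 e\<^sub>1\<^sub>2\<close> turns the left multiplication into a right
  multiplication, which reads off the other diagonal entry of the image of \<open>a\<close>.\<close>

lemma involution_UT2_swaps_diagonal: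
  fixes star :: "'a::field^2^2 \<Rightarrow> 'a^2^2"
  assumes inv: "is_involution UT star" and a: "a \<in> UT"
  shows "star a $ 0 $ 0 = a $ 1 $ 1"
proof -
  have closed: "star b \<in> UT" and invol: "star (star b) = b" if "b \<in> UT" for b
    using inv that by (auto simp: is_involution_def)
  have mult: "star (b ** c) = star c ** star b" if "b \<in> UT" "c \<in> UT" for b c
    using inv that by (auto simp: is_involution_def)
  have scale: "star (mat_scale c b) = mat_scale c (star b)" if "b \<in> UT" for b c
    using inv that by (auto simp: is_involution_def)
  have e: "E12 \<in> (UT :: ('a^2^2) set)" using E12_in_J J_subset_UT by blast
  have star0: "star 0 = 0" using scale[OF e, of 0] by simp
  have "star E12 ** star E12 = 0"
    using mult[OF e e] star0 by (simp add: J_mult_J[OF E12_in_J E12_in_J])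
  then have "star E12 \<in> J"
    using closed[OF e] by (simp add: mem_J_iff mem_UT2_iff mat2_eq_iff mat2_mult_nth)
  then obtain c where c: "star E12 = mat_scale c E12" using J_eq_scale_E12 by blast
  have "star (star E12) = mat_scale (c * c) E12" by (simp add: c scale[OF e])
  then have "c \<noteq> 0" using invol[OF e] E12_neq_0 by auto
  have "mat_scale (c * star a $ 0 $ 0) E12 = star a ** star E12"
    by (simp add: c mat_scale_mult_right UT_mult_E12 closed a)
  also have "\<dots> = star (E12 ** a)" by (rule mult[OF e a, symmetric])
  also have "\<dots> = mat_scale (c * a $ 1 $ 1) E12"
    by (simp add: E12_mult_UT a scale[OF e] c mult.commute)
  finally have "c * star a $ 0 $ 0 = c * a $ 1 $ 1"
    using E12_neq_0 mat_vs.scale_right_imp_eq by blast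
  then show ?thesis using \<open>c \<noteq> 0\<close> by simp
qed

text \<open>Below \<open>s\<close> is \<open>1\<close> for symmetric and \<open>-1\<close> for skew-symmetric elements.\<close>

lemma line_mod_J_if_diagonal_line:
  assumes V: "mat_vs.subspace V" "V \<subseteq> UT" and diag: "\<And>a. a \<in> V \<Longrightarrow> a $ 1 $ 1 = s * a $ 0 $ 0"
  shows "line_mod_J V"
proof (cases "V \<subseteq> J")
  case True
  then show ?thesis
    using mat_vs.subspace_0[OF V(1)] by (auto simp: line_mod_J_def intro!: bexI[of _ 0])
next
  case False
  then obtain w where w: "w \<in> V" "w \<notin> J" by blast
  have nz: "w $ 0 $ 0 \<noteq> 0" using w V(2) diag[OF w(1)] by (auto simp: J_def)
  have "a - mat_scale (a $ 0 $ 0 / w $ 0 $ 0) w \<in> J" if a: "a \<in> V" for a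
  proof -
    have "a \<in> UT" "w \<in> UT" using a w V by auto
    then show ?thesis
      using nz by (simp add: mem_J_iff mem_UT2_iff diag[OF a] diag[OF w(1)])
  qed
  then show ?thesis using w(1) by (auto simp: line_mod_J_def)
qed

fun var_space ::
  "('g \<Rightarrow> ('a::field^'n^'n) set) \<Rightarrow> ('a^'n^'n \<Rightarrow> 'a^'n^'n) \<Rightarrow> 'g gvar \<Rightarrow> ('a^'n^'n) set" where
  "var_space \<Gamma> star (Sym_var i g) = sym_part \<Gamma> star g"
| "var_space \<Gamma> star (Skew_var i g) = skew_part \<Gamma> star g"

fun var_degree :: "'g gvar \<Rightarrow> 'g" where
  "var_degree (Sym_var i g) = g"
| "var_degree (Skew_var i g) = g"

lemma var_space_subset: "var_space \<Gamma> star x \<subseteq> \<Gamma> (var_degree x)"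
  by (cases x) (auto simp: sym_part_def skew_part_def)

lemma (in graded_UT2) var_space_properties:
  assumes inv: "is_involution UT star" and x: "var_degree x \<in> carrier G"
  shows "mat_vs.subspace (var_space \<Gamma> star x)" "line_mod_J (var_space \<Gamma> star x)"
proof -
  define s where "s = (case x of Sym_var _ _ \<Rightarrow> 1 | Skew_var _ _ \<Rightarrow> (- 1 :: 'a))"
  have eq: "var_space \<Gamma> star x = {a \<in> \<Gamma> (var_degree x). star a = mat_scale s a}"
  proof -
    have "mat_scale (- 1) a = - a" for a :: "'a^2^2" by (simp add: mat2_eq_iff)
    then show ?thesis by (cases x) (auto simp: sym_part_def skew_part_def s_def)
  qed
  have UT: "a \<in> UT" if "a \<in> \<Gamma> (var_degree x)" for a using component_UT that x by blast
  have zero: "0 \<in> \<Gamma> (var_degree x)" by (rule mat_vs.subspace_0[OF subspace_component[OF x]])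
  have add: "star (a + b) = star a + star b" if "a \<in> UT" "b \<in> UT" for a b
    using inv that by (auto simp: is_involution_def)
  have scale: "star (mat_scale c a) = mat_scale c (star a)" if "a \<in> UT" for a c
    using inv that by (auto simp: is_involution_def)
  have "star 0 = 0" using scale[OF UT[OF zero], of 0] by simp
  then show sub: "mat_vs.subspace (var_space \<Gamma> star x)"
    unfolding eq mat_vs.subspace_def
    using zero UT add scale mat_vs.subspace_add[OF subspace_component[OF x]]
      mat_vs.subspace_scale[OF subspace_component[OF x]]
    by (auto simp: mat_vs.scale_right_distrib mult.commute)
  show "line_mod_J (var_space \<Gamma> star x)"
  proof (rule line_mod_J_if_diagonal_line[OF sub])
    show "var_space \<Gamma> star x \<subseteq> UT" using UT by (auto simp: eq)
    fix a assume "a \<in> var_space \<Gamma> star x"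
    then have "a \<in> UT" "star a = mat_scale s a" using UT by (auto simp: eq)
    then show "a $ 1 $ 1 = s * a $ 0 $ 0"
      using involution_UT2_swaps_diagonal[OF inv, of a] by simp
  qed
qed

section \<open>Images of graded polynomials with involution\<close>

lemma multilinear_in_if_multilinear_space:
  assumes "f \<in> multilinear_space m l deg"
  shows "multilinear_in (ml_var l deg ` {1..m}) f"
proof -
  let ?v = "ml_var l deg" and ?X = "ml_var l deg ` {1..m}"
  have inj: "inj ?v" by (rule injI) (auto simp: ml_var_def split: if_splits)
  show ?thesis
    using assms unfolding multilinear_space_def
  proof (induction rule: free_vs.span_induct)
    case base
    have sub: "Poly_Mapping.keys (p + q) \<subseteq> Poly_Mapping.keys p \<union> Poly_Mapping.keys q"
      for p q :: "'a gvar list \<Rightarrow>\<^sub>0 'b" by (rule Poly_Mapping.keys_add)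
    have "Poly_Mapping.keys (free_scale c p) \<subseteq> Poly_Mapping.keys p"
      for c and p :: "'a gvar list \<Rightarrow>\<^sub>0 'b"
      by (auto simp: in_keys_iff lookup_free_scale)
    with sub show ?case
      unfolding free_vs.subspace_def multilinear_in_def by (simp, blast)
  next
    case (step p)
    then obtain \<sigma> where \<sigma>: "\<sigma> permutes {1..m}"
      and "p = (\<Prod>i\<leftarrow>[1..<Suc m]. free_var (?v (\<sigma> i)))" by blast
    then have p: "p = Poly_Mapping.single (map (?v \<circ> \<sigma>) [1..<Suc m]) 1"
      using prod_list_free_var[of "map (?v \<circ> \<sigma>) [1..<Suc m]"] by (simp add: o_def)
    have "distinct (map (?v \<circ> \<sigma>) [1..<Suc m])"
      using inj permutes_inj[OF \<sigma>] by (simp add: distinct_map inj_on_def)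
    moreover have "{1..<Suc m} = {1..m}" by auto
    then have "set (map (?v \<circ> \<sigma>) [1..<Suc m]) = ?X"
      using permutes_image[OF \<sigma>] by (simp only: set_map set_upt image_comp[symmetric])
    ultimately show ?case by (simp add: p multilinear_in_def)
  qed
qed

lemma poly_image_eq:
  assumes "l \<le> m"
  shows "poly_image \<Gamma> star m l deg f =
    {poly_eval \<theta> f | \<theta>. \<forall>x\<in>ml_var l deg ` {1..m}. \<theta> x \<in> var_space \<Gamma> star x}"
proof -
  have "(\<forall>x\<in>ml_var l deg ` {1..m}. \<theta> x \<in> var_space \<Gamma> star x) \<longleftrightarrow>
      (\<forall>i\<in>{1..l}. \<theta> (Sym_var i (deg i)) \<in> sym_part \<Gamma> star (deg i)) \<and>
      (\<forall>i\<in>{l+1..m}. \<theta> (Skew_var i (deg i)) \<in> skew_part \<Gamma> star (deg i))" for \<theta>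
  proof -
    have "{1..m} = {1..l} \<union> {l+1..m}" using assms by auto
    then show ?thesis by (auto simp: ml_var_def ball_Un)
  qed
  then show ?thesis unfolding poly_image_def by simp
qed

theorem theorem3p1:
  fixes G :: "('g, 'z) monoid_scheme"
    and \<Gamma> :: "'g \<Rightarrow> ('a::alg_closed_field^2^2) set"
    and star :: "'a^2^2 \<Rightarrow> 'a^2^2"
    and m l :: nat
    and deg :: "nat \<Rightarrow> 'g"
    and f :: "('g, 'a) free_star_alg"
  assumes "CHAR('a) \<noteq> 2"
    and "group G"
    and "is_grading G UT \<Gamma>"
    and "generate G (grading_supp G \<Gamma>) = carrier G"
    and "is_graded_involution G UT \<Gamma> star"
    and "1 \<le> m" and "l \<le> m"
    and "\<forall>i\<in>{1..m}. deg i \<in> carrier G"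
    and "f \<in> multilinear_space m l deg"
  shows "is_homogeneous_subspace G UT \<Gamma> (poly_image \<Gamma> star m l deg f)"
proof -
  interpret graded_UT2 G \<Gamma>
    using assms by (simp add: graded_UT2_def graded_UT2_axioms_def graded_algebra_def
        graded_algebra_axioms_def)
  let ?X = "ml_var l deg ` {1..m}" and ?V = "var_space \<Gamma> star"
  have inv: "is_involution UT star" using assms(5) by (simp add: is_graded_involution_def)
  have f: "multilinear_in ?X f" by (rule multilinear_in_if_multilinear_space) fact
  have X: "finite ?X" "?X \<noteq> {}" using \<open>1 \<le> m\<close> by auto
  have deg: "var_degree x \<in> carrier G" if "x \<in> ?X" for x
    using that assms(8) by (auto simp: ml_var_def split: if_splits)
  have V_UT: "?V x \<subseteq> UT" if "x \<in> ?X" for x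
    using var_space_subset component_subset[OF deg[OF that]] by blast
  have image: "poly_image \<Gamma> star m l deg f = {poly_eval \<theta> f | \<theta>. \<forall>x\<in>?X. \<theta> x \<in> ?V x}"
    by (rule poly_image_eq) fact
  have subspace: "mat_vs.subspace (poly_image \<Gamma> star m l deg f)"
    unfolding image
    by (rule subspace_multilinear_image[OF f X]) (use var_space_properties[OF inv] deg V_UT in auto)
  show ?thesis
  proof (cases "\<forall>x\<in>?X. var_degree x = \<one>\<^bsub>G\<^esub>")
    case True
    have "poly_image \<Gamma> star m l deg f \<subseteq> \<Gamma> \<one>\<^bsub>G\<^esub>"
    proof
      fix v assume "v \<in> poly_image \<Gamma> star m l deg f"
      then obtain \<theta> where \<theta>: "v = poly_eval \<theta> f" "\<forall>x\<in>?X. \<theta> x \<in> ?V x" unfolding image by blast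
      have letter: "\<theta> x \<in> \<Gamma> \<one>\<^bsub>G\<^esub>" if "x \<in> ?X" for x
        using \<theta>(2) that True var_space_subset[of \<Gamma> star x] by auto
      have "word_eval \<theta> w \<in> \<Gamma> \<one>\<^bsub>G\<^esub>" if "set w \<subseteq> ?X" for w
        using that
      proof (induction w)
        case Nil
        show ?case by (simp add: one_homogeneous one_in_UT2)
      next
        case (Cons x w)
        then show ?case using component_mult[OF letter, of x "word_eval \<theta> w" "\<one>\<^bsub>G\<^esub>"] by simp
      qed
      then show "v \<in> \<Gamma> \<one>\<^bsub>G\<^esub>"
        unfolding \<theta>(1) using f
        by (intro poly_eval_in_subspace subspace_component) (auto simp: multilinear_in_def)
    qed
    then show ?thesis by (rule homogeneous_subspaceI[OF subspace _ one_closed])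
  next
    case False
    then obtain y where y: "y \<in> ?X" "var_degree y \<noteq> \<one>\<^bsub>G\<^esub>" by blast
    have "poly_image \<Gamma> star m l deg f \<subseteq> J"
    proof
      fix v assume "v \<in> poly_image \<Gamma> star m l deg f"
      then obtain \<theta> where \<theta>: "v = poly_eval \<theta> f" "\<forall>x\<in>?X. \<theta> x \<in> ?V x" unfolding image by blast
      have "\<theta> y \<in> J"
        using \<theta>(2) y var_space_subset[of \<Gamma> star y] component_in_J[OF deg] by blast
      have UT: "\<theta> x \<in> UT" if "x \<in> ?X" for x using \<theta>(2) V_UT that by blast
      show "v \<in> J"
        unfolding \<theta>(1)
      proof (rule poly_eval_in_subspace[OF subspace_J])
        fix w assume "w \<in> Poly_Mapping.keys f"
        then have "set w = ?X" using f by (auto simp: multilinear_in_def)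
        then show "word_eval \<theta> w \<in> J"
          using word_eval_J[of w \<theta> y] UT y(1) \<open>\<theta> y \<in> J\<close> by blast
      qed
    qed
    moreover obtain \<gamma> where "\<gamma> \<in> carrier G" "J \<subseteq> \<Gamma> \<gamma>" by (rule J_homogeneous)
    ultimately show ?thesis using homogeneous_subspaceI[OF subspace] by blast
  qed
qed

end
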